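(* Let $E$ be a subset of $\mathbb{N}$, let $\mu:\mathbb{N} \to \mathbb{R}^+$ be a scaling function and let $E_{\mu}=\mu(E) \cup \{0\}$. Then the following statements are equivalent. (i) The set $E$ is nonporous at infinity w.r.t. $\mu$, that is, $\overline{p}_{\mu}(E)=0$. (ii) The equality $\overline{\Omega}^{E_{\mu}}_{0, \tilde{r}}= \mathbb{R}^+$ holds for every normalizing sequence $\tilde{r}$. (iii) For every normalizing sequence $\tilde{r}$ there is a subsequence $\tilde{r}'$ such that the pretangent space $\overline{\Omega}^{E_{\mu}}_{0, \tilde{r}'}$ includes a dense subset of $(0,1)$.
   Context: $\mathbb{R}^+=[0,\infty)$. A scaling function is a strictly decreasing function $\mu:\mathbb{N}\to\mathbb{R}^+$ with $\lim_{n\to\infty}\mu(n)=0$. For $E\subseteq\mathbb{N}$ and $n\in\mathbb{N}$, $$\lambda_\mu(E,n)=\sup\{|\mu(n^{(1)})-\mu(n^{(2)})| : n\le n^{(1)}<n^{(2)},\ n^{(1)},n^{(2)}\in\mathbb{N},\ (n^{(1)},n^{(2)})\cap E=\emptyset\},$$ and the upper porosity of $E$ at infinity is $\overline{p}_\mu(E)=\limsup_{n\to\infty}\lambda_\mu(E,n)/\mu(n)$. A normalizing sequence is a sequence $\tilde r=(r_n)_{n\in\mathbb{N}}$ of positive real numbers tending to $0$. For $X\subseteq\mathbb{R}^+$ with $0\in X$, $\tilde X$ denotes the set of all sequences $(x_n)_{n\in\mathbb{N}}$ of points of $X$ with $\lim_{n\to\infty}x_n=0$. The pretangent space to $X$ at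 $0$ w.r.t. $\tilde r$ is identified with the set $\overline{\Omega}^{X}_{0,\tilde r}\subseteq\mathbb{R}^+$ of all $t\in\mathbb{R}^+$ for which there is $(x_n)\in\tilde X$ with $t=\lim_{n\to\infty}x_n/r_n$. For a subsequence $\tilde r'=(r_{n_k})_{k\in\mathbb{N}}$ of $\tilde r$, $\overline{\Omega}^{X}_{0,\tilde r'}$ is the set of all $t\in\mathbb{R}^+$ for which there is $(x_n)\in\tilde X$ with $t=\lim_{k\to\infty}x_{n_k}/r_{n_k}$. *)

theory Defs
  imports "HOL-Analysis.Analysis"
begin

definition scaling_function :: "(nat \<Rightarrow> real) \<Rightarrow> bool" where
  "scaling_function \<mu> \<longleftrightarrow> (\<forall>n. 0 \<le> \<mu> n) \<and> strict_antimono_on UNIV \<mu> \<and> \<mu> \<longlonglongrightarrow> 0"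

definition gap_lengths :: "(nat \<Rightarrow> real) \<Rightarrow> nat set \<Rightarrow> nat \<Rightarrow> real set" where
  "gap_lengths \<mu> E n =
     {\<bar>\<mu> n1 - \<mu> n2\<bar> | n1 n2. n \<le> n1 \<and> n1 < n2 \<and> {n1<..<n2} \<inter> E = {}}"

(* Sup is the supremum on real, which is meaningful only for nonempty sets that are
   bounded above; gap_lengths_nonempty and gap_lengths_bdd_above show that this is
   always the case for a scaling function. *)
definition max_gap :: "(nat \<Rightarrow> real) \<Rightarrow> nat set \<Rightarrow> nat \<Rightarrow> real" where
  "max_gap \<mu> E n = Sup (gap_lengths \<mu> E n)"

lemma gap_lengths_nonempty: "gap_lengths \<mu> E n \<noteq> {}"
proof -
  have "{n<..<Suc n} \<inter> E = {}" by auto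
  then have "\<bar>\<mu> n - \<mu> (Suc n)\<bar> \<in> gap_lengths \<mu> E n"
    unfolding gap_lengths_def by blast
  then show ?thesis by blast
qed

lemma gap_lengths_bdd_above:
  assumes "scaling_function \<mu>"
  shows "bdd_above (gap_lengths \<mu> E n)"
proof (rule bdd_aboveI)
  fix y assume "y \<in> gap_lengths \<mu> E n"
  then obtain n1 n2 where y: "y = \<bar>\<mu> n1 - \<mu> n2\<bar>" and le: "n \<le> n1" "n1 < n2"
    unfolding gap_lengths_def by blast
  have dec: "\<mu> b < \<mu> a" if "a < b" for a b
    using assms that by (simp add: scaling_function_def monotone_on_def)
  have "\<mu> n1 \<le> \<mu> n" using dec[of n n1] le(1) by (cases "n = n1") auto
  moreover have "\<mu> n2 < \<mu> n1" using dec le(2) by blast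
  moreover have "0 \<le> \<mu> n2" using assms by (simp add: scaling_function_def)
  ultimately show "y \<le> \<mu> n" using y by linarith
qed

definition upper_porosity :: "(nat \<Rightarrow> real) \<Rightarrow> nat set \<Rightarrow> ereal" where
  "upper_porosity \<mu> E = limsup (\<lambda>n. ereal (max_gap \<mu> E n / \<mu> n))"

definition normalizing_sequence :: "(nat \<Rightarrow> real) \<Rightarrow> bool" where
  "normalizing_sequence r \<longleftrightarrow> (\<forall>n. 0 < r n) \<and> r \<longlonglongrightarrow> 0"

definition null_sequences :: "real set \<Rightarrow> (nat \<Rightarrow> real) set" where
  "null_sequences X = {x. (\<forall>n. x n \<in> X) \<and> x \<longlonglongrightarrow> 0}"

(* The pretangent space to X at 0, in its identification with a subset of [0, \<infinity>). *)
definition pretangent :: "real set \<Rightarrow> (nat \<Rightarrow> real) \<Rightarrow> real set" where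
  "pretangent X r = {t. 0 \<le> t \<and> (\<exists>x \<in> null_sequences X. (\<lambda>n. x n / r n) \<longlonglongrightarrow> t)}"

(* The strictly increasing index map s stands for the subsequence r \<circ> s of r; the test
   sequences x are indexed like r itself and are passed to the same subsequence. *)
definition pretangent_subseq ::
    "real set \<Rightarrow> (nat \<Rightarrow> real) \<Rightarrow> (nat \<Rightarrow> nat) \<Rightarrow> real set" where
  "pretangent_subseq X r s =
     {t. 0 \<le> t \<and> (\<exists>x \<in> null_sequences X. (\<lambda>k. x (s k) / r (s k)) \<longlonglongrightarrow> t)}"

end

theory Submission
  imports Defs
begin

text \<open>
  Nonporosity says that for every \<open>\<epsilon>\<close>, each small enough \<open>y > 0\<close> is approximated by points of
  \<open>\<mu> ` E\<close> with relative error \<open>\<epsilon>\<close>: otherwise the indices around the window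
  \<open>[(1 - \<epsilon>) y, (1 + \<epsilon>) y]\<close> would bound a relatively long gap. Applied to \<open>y = t * r n\<close>, this
  realises every \<open>t > 0\<close> in the pretangent space. Conversely, if the porosity is positive, there are
  gaps of relative length more than a fixed \<open>c > 0\<close> arbitrarily far out. Normalising by the upper
  ends of these gaps keeps \<open>(1 - c, 1)\<close> out of the pretangent space along every subsequence.
\<close>

context
  fixes \<mu> :: "nat \<Rightarrow> real"
  assumes scaling: "scaling_function \<mu>"
begin

lemma scaling_less_iff: "\<mu> m < \<mu> n \<longleftrightarrow> n < m"
proof -
  have "\<mu> b < \<mu> a" if "a < b" for a b
    using scaling that by (simp add: scaling_function_def monotone_on_def)
  then show ?thesis
    by (metis less_asym less_irrefl linorder_neqE_nat)
qed

lemma scaling_le_iff: "\<mu> m \<le> \<mu> n \<longleftrightarrow> n \<le> m"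
  using scaling_less_iff[of n m] by (simp flip: not_less)

lemma scaling_pos: "0 < \<mu> n"
proof -
  have "0 \<le> \<mu> (Suc n)"
    using scaling by (simp add: scaling_function_def)
  also have "\<dots> < \<mu> n"
    by (simp add: scaling_less_iff)
  finally show ?thesis .
qed

lemma scaling_tendsto_0: "\<mu> \<longlonglongrightarrow> 0"
  using scaling by (simp add: scaling_function_def)

lemma gap_le_max_gap:
  assumes "n \<le> n1" "n1 < n2" "{n1<..<n2} \<inter> E = {}"
  shows "\<mu> n1 - \<mu> n2 \<le> max_gap \<mu> E n"
proof -
  have "\<mu> n1 - \<mu> n2 \<le> \<bar>\<mu> n1 - \<mu> n2\<bar>"
    by simp
  also have "\<dots> \<le> max_gap \<mu> E n"
    unfolding max_gap_def
    using assms by (intro cSup_upper gap_lengths_bdd_above[OF scaling]) (auto simp: gap_lengths_def)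
  finally show ?thesis .
qed

lemma less_max_gapE:
  assumes "c < max_gap \<mu> E n"
  obtains n1 n2 where "n \<le> n1" "n1 < n2" "{n1<..<n2} \<inter> E = {}" "c < \<mu> n1 - \<mu> n2"
proof -
  obtain d where "d \<in> gap_lengths \<mu> E n" "c < d"
    using assms less_cSup_iff[OF gap_lengths_nonempty gap_lengths_bdd_above[OF scaling]]
    unfolding max_gap_def by blast
  then obtain n1 n2 where "n \<le> n1" "n1 < n2" "{n1<..<n2} \<inter> E = {}" "c < \<bar>\<mu> n1 - \<mu> n2\<bar>"
    unfolding gap_lengths_def by blast
  moreover have "\<mu> n2 < \<mu> n1"
    using \<open>n1 < n2\<close> by (simp add: scaling_less_iff)
  ultimately show ?thesis
    by (intro that[of n1 n2]) auto
qed

lemma max_gap_nonneg: "0 \<le> max_gap \<mu> E n"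
proof -
  have "\<mu> (Suc n) < \<mu> n"
    by (simp add: scaling_less_iff)
  moreover have "{n<..<Suc n} \<inter> E = {}"
    by auto
  ultimately show ?thesis
    using gap_le_max_gap[of n n "Suc n" E] by simp
qed

text \<open>The quotients are nonnegative, so their limsup vanishes exactly when it is at most 0,
  which unfolds into an epsilon condition. Extended real thresholds reduce to real ones, an infinite
  one being trivial.\<close>

lemma upper_porosity_eq_0_iff:
  "upper_porosity \<mu> E = 0 \<longleftrightarrow> (\<forall>c>0. \<forall>\<^sub>F n in sequentially. max_gap \<mu> E n < c * \<mu> n)"
proof -
  have "0 \<le> upper_porosity \<mu> E"
    unfolding upper_porosity_def
    by (intro le_Limsup) (auto intro!: always_eventually divide_nonneg_pos max_gap_nonneg scaling_pos)
  then have "upper_porosity \<mu> E = 0 \<longleftrightarrow> upper_porosity \<mu> E \<le> 0"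
    by auto
  also have "\<dots> \<longleftrightarrow> (\<forall>y>0. \<forall>\<^sub>F n in sequentially. ereal (max_gap \<mu> E n / \<mu> n) < y)"
    by (simp add: upper_porosity_def Limsup_le_iff)
  also have "\<dots> \<longleftrightarrow> (\<forall>c>0. \<forall>\<^sub>F n in sequentially. ereal (max_gap \<mu> E n / \<mu> n) < ereal c)"
  proof (intro iffI allI impI)
    fix y :: ereal
    assume *: "\<forall>c>0. \<forall>\<^sub>F n in sequentially. ereal (max_gap \<mu> E n / \<mu> n) < ereal c" and "0 < y"
    then show "\<forall>\<^sub>F n in sequentially. ereal (max_gap \<mu> E n / \<mu> n) < y"
      by (cases y) auto
  qed (metis ereal_less(2))
  also have "\<dots> \<longleftrightarrow> (\<forall>c>0. \<forall>\<^sub>F n in sequentially. max_gap \<mu> E n < c * \<mu> n)"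
    by (simp add: pos_divide_less_eq scaling_pos)
  finally show ?thesis .
qed

lemma last_index_above:
  assumes "0 < y" "y < \<mu> N"
  obtains n where "N \<le> n" "y < \<mu> n" "\<And>m. n < m \<Longrightarrow> \<mu> m \<le> y"
proof -
  let ?m = "LEAST m. \<mu> m \<le> y"
  have "\<exists>m. \<mu> m \<le> y"
    using eventually_happens'[OF sequentially_bot order_tendstoD(2)[OF scaling_tendsto_0 \<open>0 < y\<close>]]
    by (blast intro: less_imp_le)
  then have m: "\<mu> ?m \<le> y"
    by (rule LeastI_ex)
  then have N: "N < ?m"
    using assms(2) by (simp flip: scaling_less_iff)
  show ?thesis
  proof
    \<comment> \<open>Since \<open>N < ?m\<close>, the index \<open>?m\<close> is positive and
      \<open>?m - 1\<close> is its true predecessor, where minimality of \<open>?m\<close> keeps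
      \<open>\<mu>\<close> above \<open>y\<close>.\<close>
    show "N \<le> ?m - 1"
      using N by simp
    show "y < \<mu> (?m - 1)"
      using N not_less_Least[of "?m - 1" "\<lambda>m. \<mu> m \<le> y"] by simp
    show "\<mu> k \<le> y" if "?m - 1 < k" for k
    proof -
      have "\<mu> k \<le> \<mu> ?m"
        using that by (simp add: scaling_le_iff)
      with m show ?thesis by simp
    qed
  qed
qed

text \<open>If no \<open>\<mu> e\<close> with \<open>e \<in> E\<close> came this close to
  \<open>y\<close>, the last index above a window around \<open>y\<close> and the first index below
  it would bound a gap too long for the porosity estimate.\<close>

lemma nonporous_approx:
  assumes "upper_porosity \<mu> E = 0" "0 < \<epsilon>"
  shows "\<exists>\<delta>>0. \<forall>y. 0 < y \<and> y < \<delta> \<longrightarrow> (\<exists>e\<in>E. \<bar>\<mu> e - y\<bar> \<le> \<epsilon> * y)"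
proof -
  \<comment> \<open>Capping at 1/2 keeps \<open>1 - \<eta>\<close> positive: the lower end of the
    window is then positive, so \<open>\<mu>\<close> falls below it, and the factor
    \<open>1 - \<eta>\<close> can be cancelled at the end.\<close>
  define \<eta> where "\<eta> = min \<epsilon> (1/2)"
  have \<eta>: "0 < \<eta>" "\<eta> < 1" "\<eta> \<le> \<epsilon>"
    using assms(2) by (auto simp: \<eta>_def)
  obtain N where N: "max_gap \<mu> E n < \<eta> * \<mu> n" if "N \<le> n" for n
    using assms(1) \<eta>(1) unfolding upper_porosity_eq_0_iff eventually_sequentially by blast
  show ?thesis
  proof (intro exI conjI allI impI)
    \<comment> \<open>This bound puts the upper end \<open>(1 + \<eta>) * y\<close> of the window
      below \<open>\<mu> N\<close>, so the last index above the window is at least \<open>N\<close>,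
      where the gap estimate holds.\<close>
    show "0 < \<mu> N / (1 + \<eta>)"
      using \<eta> scaling_pos by simp
    fix y assume y: "0 < y \<and> y < \<mu> N / (1 + \<eta>)"
    show "\<exists>e\<in>E. \<bar>\<mu> e - y\<bar> \<le> \<epsilon> * y"
    proof (rule ccontr)
      assume no: "\<not> ?thesis"
      have "0 < (1 + \<eta>) * y" "(1 + \<eta>) * y < \<mu> N"
        using y \<eta> by (auto simp: pos_less_divide_eq mult.commute)
      then obtain n1 where n1: "N \<le> n1" "(1 + \<eta>) * y < \<mu> n1" "\<And>m. n1 < m \<Longrightarrow> \<mu> m \<le> (1 + \<eta>) * y"
        using last_index_above by blast
      define n2 where "n2 = (LEAST m. \<mu> m < (1 - \<eta>) * y)"
      have "0 < (1 - \<eta>) * y"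
        using y \<eta> by simp
      then have "\<exists>m. \<mu> m < (1 - \<eta>) * y"
        by (intro eventually_happens'[OF sequentially_bot] order_tendstoD(2)[OF scaling_tendsto_0])
      then have n2: "\<mu> n2 < (1 - \<eta>) * y"
        unfolding n2_def by (rule LeastI_ex)
      have "(1 - \<eta>) * y \<le> (1 + \<eta>) * y"
        using y \<eta> by simp
      then have "n1 < n2"
        using n1(2) n2 by (simp flip: scaling_less_iff)
      moreover have "{n1<..<n2} \<inter> E = {}"
      proof safe
        fix m assume m: "m \<in> {n1<..<n2}" "m \<in> E"
        then have "\<mu> m \<le> (1 + \<eta>) * y" "(1 - \<eta>) * y \<le> \<mu> m"
          using n1(3) not_less_Least[of m "\<lambda>m. \<mu> m < (1 - \<eta>) * y"] by (auto simp: n2_def)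
        then have "\<bar>\<mu> m - y\<bar> \<le> \<eta> * y"
          by (simp add: algebra_simps abs_le_iff)
        also have "\<dots> \<le> \<epsilon> * y"
          using \<eta> y by (simp add: mult_right_mono)
        finally show "m \<in> {}"
          using no m by blast
      qed
      \<comment> \<open>The gap starts at \<open>n1\<close>, so its length is measured against
        \<open>\<mu> n1\<close> itself. As \<open>\<mu> n2\<close> lies below the window, this
        forces \<open>\<mu> n1 < y\<close>, although \<open>\<mu> n1\<close> lies above the
        window.\<close>
      ultimately have "\<mu> n1 - \<mu> n2 < \<eta> * \<mu> n1"
        using gap_le_max_gap[of n1 n1 n2 E] N[OF n1(1)] by simp
      then have "(1 - \<eta>) * \<mu> n1 < (1 - \<eta>) * y"
        using n2 by (simp add: algebra_simps)
      then have "\<mu> n1 < y"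
        using \<eta> by simp
      moreover have "y \<le> (1 + \<eta>) * y"
        using \<eta> y by simp
      ultimately show False
        using n1(2) by simp
    qed
  qed
qed

text \<open>For \<open>t > 0\<close>, take \<open>x n\<close> to be an almost nearest point to
  \<open>t * r n\<close>. This choice does not depend on an accuracy, so one sequence inherits the
  approximations for all accuracies.\<close>

lemma pretangent_eq_if_nonporous:
  assumes "upper_porosity \<mu> E = 0" "normalizing_sequence r"
  shows "pretangent (\<mu> ` E \<union> {0}) r = {0..}"
proof -
  let ?X = "\<mu> ` E \<union> {0}"
  have r: "0 < r n" "r \<longlonglongrightarrow> 0" for n
    using assms(2) by (auto simp: normalizing_sequence_def)
  have "t \<in> pretangent ?X r" if "0 \<le> t" for t
  proof (cases "t = 0")
    case True
    have "(\<lambda>_. 0) \<in> null_sequences ?X"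
      by (simp add: null_sequences_def)
    then show ?thesis
      using True by (auto simp: pretangent_def intro!: bexI[of _ "\<lambda>_. 0"])
  next
    case False
    define y where "y = (\<lambda>n. t * r n)"
    have y: "0 < y n" "y \<longlonglongrightarrow> 0" for n
      using False that r tendsto_mult_right_zero[OF r(2), of t] by (auto simp: y_def)
    \<comment> \<open>The slack is negligible relative to \<open>y n\<close> in the limit; with it,
      the infimum need not be shown to be attained.\<close>
    have "\<exists>a\<in>?X. dist (y n) a < infdist (y n) ?X + y n / real (Suc n)" for n
    proof (rule ccontr)
      assume "\<not> ?thesis"
      then have "infdist (y n) ?X + y n / real (Suc n) \<le> (INF a\<in>?X. dist (y n) a)"
        by (intro cINF_greatest) (auto simp: not_less)
      also have "\<dots> = infdist (y n) ?X"
        by (simp add: infdist_def)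
      finally show False
        using y(1)[of n] by (simp add: field_simps)
    qed
    then obtain x where x: "x n \<in> ?X" "dist (y n) (x n) < infdist (y n) ?X + y n / real (Suc n)" for n
      by metis
    have lim: "(\<lambda>n. x n / r n) \<longlonglongrightarrow> t"
    proof (rule tendstoI)
      fix e :: real assume "0 < e"
      \<comment> \<open>The infimum distance and the slack each contribute at most
        \<open>\<epsilon> * y n\<close>, and \<open>2 * \<epsilon> * t = e\<close>.\<close>
      define \<epsilon> where "\<epsilon> = e / (2 * t)"
      have "0 < \<epsilon>"
        using \<open>0 < e\<close> False that by (simp add: \<epsilon>_def)
      obtain \<delta> where \<delta>: "0 < \<delta>" "\<And>z. 0 < z \<Longrightarrow> z < \<delta> \<Longrightarrow> \<exists>e\<in>E. \<bar>\<mu> e - z\<bar> \<le> \<epsilon> * z"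
        using nonporous_approx[OF assms(1) \<open>0 < \<epsilon>\<close>] by blast
      have "\<forall>\<^sub>F n in sequentially. y n < \<delta>"
        using y(2) \<delta>(1) by (rule order_tendstoD)
      moreover have "\<forall>\<^sub>F n in sequentially. inverse (real (Suc n)) < \<epsilon>"
        using LIMSEQ_inverse_real_of_nat \<open>0 < \<epsilon>\<close> by (rule order_tendstoD)
      ultimately show "\<forall>\<^sub>F n in sequentially. dist (x n / r n) t < e"
      proof eventually_elim
        case (elim n)
        obtain k where k: "k \<in> E" "\<bar>\<mu> k - y n\<bar> \<le> \<epsilon> * y n"
          using \<delta>(2) y(1) elim(1) by blast
        have "infdist (y n) ?X \<le> dist (y n) (\<mu> k)"
          using k(1) by (intro infdist_le) auto
        also have "\<dots> \<le> \<epsilon> * y n"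
          using k(2) by (simp add: dist_real_def abs_minus_commute)
        finally have "dist (y n) (x n) < \<epsilon> * y n + inverse (real (Suc n)) * y n"
          using x(2)[of n] by (simp add: divide_inverse mult.commute)
        also have "\<dots> \<le> \<epsilon> * y n + \<epsilon> * y n"
          using elim(2) y(1)[of n] by (intro add_left_mono mult_right_mono) auto
        also have "\<dots> = e * r n"
          using False by (simp add: y_def \<epsilon>_def)
        finally have "\<bar>x n - t * r n\<bar> < e * r n"
          by (simp add: dist_real_def y_def abs_minus_commute)
        moreover have "x n / r n - t = (x n - t * r n) / r n"
          using r(1)[of n] by (simp add: field_simps)
        ultimately show ?case
          using r(1)[of n] by (simp add: dist_real_def pos_divide_less_eq)
      qed
    qed
    \<comment> \<open>Convergence of the quotients already forces \<open>x\<close> to tend to 0,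
      because \<open>r\<close> does.\<close>
    have "(\<lambda>n. x n / r n * r n) \<longlonglongrightarrow> t * 0"
      by (intro tendsto_mult lim r(2))
    moreover have "x n / r n * r n = x n" for n
      using r(1)[of n] by simp
    ultimately have "x \<in> null_sequences ?X"
      using x(1) by (simp add: null_sequences_def)
    then show ?thesis
      unfolding pretangent_def using lim that by blast
  qed
  then show ?thesis
    by (auto simp: pretangent_def)
qed

text \<open>With \<open>r\<close> running through upper ends of long gaps, every quotient of a point
  of the space by \<open>r n\<close> avoids one fixed interval. The interval is open, so no limit of
  such quotients lies in it, whatever the index map \<open>s\<close>.\<close>

lemma porous_pretangent_gap:
  assumes "upper_porosity \<mu> E \<noteq> 0"
  obtains r c where "normalizing_sequence r" "0 < c" "c < 1"
    "\<And>s. pretangent_subseq (\<mu> ` E \<union> {0}) r s \<inter> {c<..<1} = {}"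
proof -
  obtain c where "0 < c" and c: "\<exists>\<^sub>F n in sequentially. c * \<mu> n \<le> max_gap \<mu> E n"
    using assms by (auto simp: upper_porosity_eq_0_iff frequently_def not_le)
  \<comment> \<open>Being strictly below \<open>c\<close>, \<open>d\<close> leaves room to pick an
    actual gap from the supremum; being below 1, it makes \<open>1 - d\<close> positive, which later
    excludes the point 0.\<close>
  define d where "d = min c 1 / 2"
  have d: "0 < d" "d < 1" "d < c"
    using \<open>0 < c\<close> by (auto simp: d_def min_def)
  have "\<exists>p\<ge>N. \<forall>e\<in>E. \<not> ((1 - d) * \<mu> p < \<mu> e \<and> \<mu> e < \<mu> p)" for N
  proof -
    obtain n where n: "N \<le> n" "c * \<mu> n \<le> max_gap \<mu> E n"
      using c by (auto simp: frequently_sequentially)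
    have "d * \<mu> n < c * \<mu> n"
      using d scaling_pos by simp
    then have "d * \<mu> n < max_gap \<mu> E n"
      using n by simp
    then obtain p q where pq: "n \<le> p" "p < q" "{p<..<q} \<inter> E = {}" "d * \<mu> n < \<mu> p - \<mu> q"
      by (rule less_max_gapE)
    \<comment> \<open>Passing from \<open>n\<close> to the start \<open>p\<close> of the gap only
      lowers the reference value, so the gap is also long relative to
      \<open>\<mu> p\<close>.\<close>
    have "d * \<mu> p \<le> d * \<mu> n"
      using pq d by (simp add: scaling_le_iff)
    then have "\<mu> q < (1 - d) * \<mu> p"
      using pq(4) by (simp add: algebra_simps)
    have "\<not> ((1 - d) * \<mu> p < \<mu> e \<and> \<mu> e < \<mu> p)" if "e \<in> E" for e
    proof
      assume "(1 - d) * \<mu> p < \<mu> e \<and> \<mu> e < \<mu> p"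
      then have "\<mu> q < \<mu> e" "\<mu> e < \<mu> p"
        using \<open>\<mu> q < (1 - d) * \<mu> p\<close> by auto
      then have "e \<in> {p<..<q}"
        by (simp add: scaling_less_iff)
      then show False
        using that pq(3) by blast
    qed
    then show ?thesis
      using n(1) pq(1) by (meson order_trans)
  qed
  then obtain p where p: "N \<le> p N" "e \<in> E \<Longrightarrow> \<not> ((1 - d) * \<mu> (p N) < \<mu> e \<and> \<mu> e < \<mu> (p N))" for N e
    by metis
  show ?thesis
  proof
    have "filterlim p at_top sequentially"
      using p(1) by (intro filterlim_at_top_mono[OF filterlim_ident]) auto
    then have "(\<lambda>n. \<mu> (p n)) \<longlonglongrightarrow> 0"
      by (rule filterlim_compose[OF scaling_tendsto_0])
    then show "normalizing_sequence (\<lambda>n. \<mu> (p n))"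
      by (simp add: normalizing_sequence_def scaling_pos)
    show "0 < 1 - d" "1 - d < 1"
      using d by auto
    fix s
    show "pretangent_subseq (\<mu> ` E \<union> {0}) (\<lambda>n. \<mu> (p n)) s \<inter> {1 - d<..<1} = {}"
    proof safe
      fix t assume t: "t \<in> {1 - d<..<1}" "t \<in> pretangent_subseq (\<mu> ` E \<union> {0}) (\<lambda>n. \<mu> (p n)) s"
      then obtain x where x: "x n \<in> \<mu> ` E \<union> {0}" "(\<lambda>k. x (s k) / \<mu> (p (s k))) \<longlonglongrightarrow> t" for n
        by (auto simp: pretangent_subseq_def null_sequences_def)
      have "\<forall>\<^sub>F k in sequentially. x (s k) / \<mu> (p (s k)) \<in> {1 - d<..<1}"
        using t(1) by (intro topological_tendstoD[OF x(2)]) auto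
      then obtain k where "x (s k) / \<mu> (p (s k)) \<in> {1 - d<..<1}"
        by (auto simp: eventually_sequentially)
      then have k: "(1 - d) * \<mu> (p (s k)) < x (s k)" "x (s k) < \<mu> (p (s k))"
        by (simp_all add: pos_less_divide_eq pos_divide_less_eq scaling_pos)
      have "0 < (1 - d) * \<mu> (p (s k))"
        using d scaling_pos by simp
      then have "x (s k) \<noteq> 0"
        using k(1) by simp
      then obtain e where "e \<in> E" "x (s k) = \<mu> e"
        using x(1)[of "s k"] by auto
      then show "t \<in> {}"
        using p(2) k by metis
    qed
  qed
qed

end

theorem theorem3p17:
  fixes E :: "nat set" and \<mu> :: "nat \<Rightarrow> real" and E\<^sub>\<mu> :: "real set"
  assumes "scaling_function \<mu>"
    and "E\<^sub>\<mu> = \<mu> ` E \<union> {0}"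
  shows "(upper_porosity \<mu> E = 0
            \<longleftrightarrow> (\<forall>r. normalizing_sequence r \<longrightarrow> pretangent E\<^sub>\<mu> r = {0..}))
       \<and> ((\<forall>r. normalizing_sequence r \<longrightarrow> pretangent E\<^sub>\<mu> r = {0..})
            \<longleftrightarrow> (\<forall>r. normalizing_sequence r \<longrightarrow>
                  (\<exists>s. strict_mono s \<and>
                     (\<exists>D. D \<subseteq> pretangent_subseq E\<^sub>\<mu> r s \<and>
                          D \<subseteq> {0<..<1} \<and> {0<..<1} \<subseteq> closure D))))"
    (is "(?i \<longleftrightarrow> ?ii) \<and> (_ \<longleftrightarrow> ?iii)")
proof -
  \<comment> \<open>The equivalences follow from a cycle of three implications.\<close>
  have "?ii" if ?i
    using pretangent_eq_if_nonporous[OF assms(1) that] assms(2) by blast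
  moreover have "?iii" if ?ii
  proof (intro allI impI)
    fix r assume "normalizing_sequence r"
    \<comment> \<open>The full sequence serves as the subsequence, and the whole interval as the
      dense set.\<close>
    with that have "pretangent_subseq E\<^sub>\<mu> r id = {0..}"
      by (simp add: pretangent_def pretangent_subseq_def)
    moreover have "{0<..<1} \<subseteq> {0 :: real..}"
      by (simp add: subset_iff)
    moreover have "strict_mono (id :: nat \<Rightarrow> nat)"
      by (simp add: strict_mono_def)
    moreover have "{0<..<1} \<subseteq> closure {0<..<1 :: real}"
      by (rule closure_subset)
    ultimately show "\<exists>s. strict_mono s \<and> (\<exists>D. D \<subseteq> pretangent_subseq E\<^sub>\<mu> r s \<and>
        D \<subseteq> {0<..<1} \<and> {0<..<1} \<subseteq> closure D)"
      by (intro exI[of _ id] exI[of _ "{0<..<1}"] conjI) (simp_all only: order_refl)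
  qed
  moreover have "?i" if ?iii
  proof (rule ccontr)
    assume "\<not> ?i"
    then obtain r c where r: "normalizing_sequence r" and c: "0 < c" "c < 1"
      and gap: "\<And>s. pretangent_subseq E\<^sub>\<mu> r s \<inter> {c<..<1} = {}"
      using porous_pretangent_gap[OF assms(1), of E] unfolding assms(2) by blast
    obtain s D where D: "D \<subseteq> pretangent_subseq E\<^sub>\<mu> r s" "{0<..<1} \<subseteq> closure D"
      using \<open>?iii\<close> r by blast
    \<comment> \<open>Density puts the midpoint of the excluded interval into the closure of
      \<open>D\<close>, but an open set that misses \<open>D\<close> also misses its
      closure.\<close>
    have "(c + 1) / 2 \<in> {c<..<1} \<inter> closure D"
      using c D(2) by auto
    moreover have "{c<..<1} \<inter> closure D = {}"
      using D(1) gap[of s] by (subst open_Int_closure_eq_empty) auto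
    ultimately show False
      by blast
  qed
  ultimately show ?thesis
    by blast
qed

end
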